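(* Let $X$ be a compact Hausdorff space and $X=Y\cup Z$, where $Y$ is a proper dense subspace of $X$ which is an E-space, and $Z$ is $F_{\aleph_0}$-embedded in $X$. Then $X\neq \beta Y$ (i.e., $X$ is not the Stone–Čech compactification of $Y$).
   Context: "Space" means topological $T_0$-space. A subset of a space $X$ is a zero-set (resp. cozero-set) if it is $f^{-1}(0)$ (resp. $X\setminus f^{-1}(0)$) for some continuous $f:X\to[0,1]$. A U-representation of a subset $V$ of $X$ is a sequence $(U_n(V))_{n\in\mathbb{N}}$ with $V=\bigcup_n U_n(V)$, $U_n(V)\subseteq U_{n+1}(V)$, $U_{2n-1}(V)$ a zero-set and $U_{2n}(V)$ a cozero-set for all $n\geq 1$. A family $\alpha$ of subsets of $X$ is an almost subbase of $X$ if one can choose a U-representation of each $V\in\alpha$ such that $\alpha\cup\{X\setminus U_{2n-1}(V): V\in\alpha, n\in\mathbb{N}\}$ is a subbase of $X$. A family of subsets of a set is strongly point-finite if every countably infinite subfamily contains a finite subfamily with empty intersection; $\sigma$-strongly point-finite means a countable union of strongly point-finite families. A space is an E-space if it has a $\sigma$-strongly point-finite almost subbase. A family $\mathcal{U}$ of subsets of $X$ F-separates $S\subseteq X$ if for distinct $x,y\in S$ there is $U\in\mathcal{U}$ with $x\in U$, $y\notin\mathrm{cl}_X(U)$, or vice versa. For a cardinal $\tau$, a subspace $S$ of $X$ is $F_\tau$-embedded in $X$ if there is a family of open subsets of $X$ which is the union of $\tau$ point-finite families of open subsets of $X$ and which F-separates $S$. *)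

theory Defs
  imports "HOL-Analysis.Analysis"
begin

definition zero_set :: "'a topology \<Rightarrow> 'a set \<Rightarrow> bool" where
  "zero_set X A \<longleftrightarrow> (\<exists>f. continuous_map X euclideanreal f \<and> f ` topspace X \<subseteq> {0..1}
      \<and> A = {x \<in> topspace X. f x = 0})"

definition cozero_set :: "'a topology \<Rightarrow> 'a set \<Rightarrow> bool" where
  "cozero_set X A \<longleftrightarrow> (\<exists>f. continuous_map X euclideanreal f \<and> f ` topspace X \<subseteq> {0..1}
      \<and> A = topspace X - {x \<in> topspace X. f x = 0})"

text \<open>U-representation (U n)_{n \<ge> 1} of V; the value at index 0 is irrelevant.\<close>
definition U_representation :: "'a topology \<Rightarrow> 'a set \<Rightarrow> (nat \<Rightarrow> 'a set) \<Rightarrow> bool" where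
  "U_representation X V U \<longleftrightarrow>
     V = (\<Union>n\<in>{1..}. U n) \<and>
     (\<forall>n\<ge>1. U n \<subseteq> U (Suc n)) \<and>
     (\<forall>n\<ge>1. zero_set X (U (2*n - 1)) \<and> cozero_set X (U (2*n)))"

definition subbase :: "'a topology \<Rightarrow> 'a set set \<Rightarrow> bool" where
  "subbase X S \<longleftrightarrow> (\<forall>U\<in>S. openin X U) \<and>
     (\<forall>U. openin X U \<longrightarrow> (\<forall>x\<in>U. \<exists>F. finite F \<and> F \<subseteq> S \<and>
          x \<in> topspace X \<inter> \<Inter>F \<and> topspace X \<inter> \<Inter>F \<subseteq> U))"

definition almost_subbase :: "'a topology \<Rightarrow> 'a set set \<Rightarrow> bool" where
  "almost_subbase X \<alpha> \<longleftrightarrow> (\<exists>R :: 'a set \<Rightarrow> nat \<Rightarrow> 'a set.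
     (\<forall>V\<in>\<alpha>. U_representation X V (R V)) \<and>
     subbase X (\<alpha> \<union> {topspace X - R V (2*n - 1) | V n. V \<in> \<alpha> \<and> n \<ge> 1}))"

definition strongly_point_finite :: "'a set set \<Rightarrow> bool" where
  "strongly_point_finite \<A> \<longleftrightarrow> (\<forall>\<B>\<subseteq>\<A>. countable \<B> \<and> infinite \<B> \<longrightarrow>
     (\<exists>\<F>\<subseteq>\<B>. finite \<F> \<and> \<F> \<noteq> {} \<and> \<Inter>\<F> = {}))"

definition sigma_strongly_point_finite :: "'a set set \<Rightarrow> bool" where
  "sigma_strongly_point_finite \<A> \<longleftrightarrow> (\<exists>A :: nat \<Rightarrow> 'a set set.
     \<A> = (\<Union>n. A n) \<and> (\<forall>n. strongly_point_finite (A n)))"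

definition E_space :: "'a topology \<Rightarrow> bool" where
  "E_space X \<longleftrightarrow> (\<exists>\<alpha>. almost_subbase X \<alpha> \<and> sigma_strongly_point_finite \<alpha>)"

definition point_finite :: "'a topology \<Rightarrow> 'a set set \<Rightarrow> bool" where
  "point_finite X \<U> \<longleftrightarrow> (\<forall>x\<in>topspace X. finite {U\<in>\<U>. x \<in> U})"

definition F_separates :: "'a topology \<Rightarrow> 'a set set \<Rightarrow> 'a set \<Rightarrow> bool" where
  "F_separates X \<U> S \<longleftrightarrow> (\<forall>x\<in>S. \<forall>y\<in>S. x \<noteq> y \<longrightarrow>
     (\<exists>U\<in>\<U>. (x \<in> U \<and> y \<notin> X closure_of U) \<or> (y \<in> U \<and> x \<notin> X closure_of U)))"

definition F_aleph0_embedded :: "'a topology \<Rightarrow> 'a set \<Rightarrow> bool" where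
  "F_aleph0_embedded X S \<longleftrightarrow> S \<subseteq> topspace X \<and> (\<exists>\<U> :: nat \<Rightarrow> 'a set set.
     (\<forall>n. (\<forall>U\<in>\<U> n. openin X U) \<and> point_finite X (\<U> n)) \<and>
     F_separates X (\<Union>n. \<U> n) S)"

text \<open>X is (a copy of) the Stone-Cech compactification of Y, with Y sitting inside X:
  X compact Hausdorff, Y dense in X, and Y C*-embedded in X.\<close>
definition is_stone_cech :: "'a topology \<Rightarrow> 'a set \<Rightarrow> bool" where
  "is_stone_cech X Y \<longleftrightarrow> compact_space X \<and> Hausdorff_space X \<and> Y \<subseteq> topspace X \<and>
     X closure_of Y = topspace X \<and>
     (\<forall>f. continuous_map (subtopology X Y) euclideanreal f \<and> bounded (f ` Y) \<longrightarrow>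
        (\<exists>g. continuous_map X euclideanreal g \<and> (\<forall>y\<in>Y. g y = f y)))"

end

theory Submission
  imports Defs
begin

text \<open>Suppose \<open>X = \<beta>Y\<close>. The sets of a \<open>\<sigma>\<close>-strongly point-finite almost subbase of \<open>Y\<close> give functions
  on \<open>Y\<close> whose extensions to \<open>X\<close> separate the points of \<open>Y\<close> from all other points of \<open>X\<close>, and strong
  point-finiteness on the dense set \<open>Y\<close> makes the supports of the extensions point-finite on \<open>X\<close>.
  Together with the sets separating \<open>Z\<close>, a \<open>\<sigma>\<close>-point-finite family of open sets F-separates all of
  \<open>X\<close>. As in the Preiss--Simon theorem, a point \<open>p\<close> outside \<open>Y\<close> is then the limit of disjoint nonempty
  open sets \<open>W n\<close>, locally finite away from \<open>p\<close>. Summing bump functions on the \<open>W n\<close> with \<open>n\<close> even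
  gives a bounded continuous function on \<open>Y\<close> that oscillates at \<open>p\<close>, so it does not extend.\<close>

section \<open>Point-finite open families and disjoint open sets converging to a point\<close>

lemma dense_meets_openin:
  assumes "X closure_of Y = topspace X" "openin X T" "x \<in> T"
  obtains y where "y \<in> Y" "y \<in> T"
proof -
  have "x \<in> X closure_of Y"
    using assms openin_subset by blast
  with assms that show ?thesis
    unfolding in_closure_of by blast
qed

lemma point_finite_UN:
  assumes "finite I" "\<And>i. i \<in> I \<Longrightarrow> point_finite X (\<U> i)"
  shows "point_finite X (\<Union>i\<in>I. \<U> i)"
proof -
  have "{U \<in> (\<Union>i\<in>I. \<U> i). x \<in> U} = (\<Union>i\<in>I. {U \<in> \<U> i. x \<in> U})" for x
    by auto
  with assms show ?thesis
    by (simp add: point_finite_def)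
qed

text \<open>Every nonempty open set has a nonempty open subset on which membership in each set of the
  family is constant: by Baire some open subset meets boundedly many sets at each point, and one
  shrinks around a point lying in the maximal number of them.\<close>
lemma point_finite_stable_open:
  assumes X: "compact_space X" "Hausdorff_space X"
    and op: "\<And>V. V \<in> \<V> \<Longrightarrow> openin X V" and pf: "point_finite X \<V>"
    and W: "openin X W" "W \<noteq> {}"
  obtains W' where "openin X W'" "W' \<noteq> {}" "W' \<subseteq> W" "\<And>V. V \<in> \<V> \<Longrightarrow> W' \<subseteq> V \<or> W' \<inter> V = {}"
proof -
  define M where "M x = {V \<in> \<V>. x \<in> V}" for x
  have fin: "finite (M x)" if "x \<in> topspace X" for x
    using pf that by (simp add: M_def point_finite_def)
  have opM: "openin X (topspace X \<inter> \<Inter>(M x))" if "x \<in> topspace X" for x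
    using fin[OF that] op by (intro openin_Int_Inter) (auto simp: M_def)
  define G where "G n = {x \<in> topspace X. n < card (M x)}" for n
  have mono: "card (M x) \<le> card (M y)" "M x \<subseteq> M y" if "x \<in> topspace X" "y \<in> topspace X \<inter> \<Inter>(M x)" for x y
  proof -
    show "M x \<subseteq> M y" using that by (auto simp: M_def)
    then show "card (M x) \<le> card (M y)" using fin that by (simp add: card_mono)
  qed
  \<comment> \<open>Multiplicity is lower semicontinuous: the finitely many sets through
    \<open>x\<close> meet in a neighbourhood of \<open>x\<close> on which no membership is
    lost.\<close>
  have opG: "openin X (G n)" for n
  proof (subst openin_subopen, intro ballI)
    fix x assume "x \<in> G n"
    then have x: "x \<in> topspace X" "n < card (M x)" by (auto simp: G_def)
    have "topspace X \<inter> \<Inter>(M x) \<subseteq> G n"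
    proof
      fix y assume "y \<in> topspace X \<inter> \<Inter>(M x)"
      then show "y \<in> G n" using mono(1)[OF x(1), of y] x(2) by (simp add: G_def)
    qed
    moreover have "x \<in> topspace X \<inter> \<Inter>(M x)" using x by (auto simp: M_def)
    ultimately show "\<exists>T. openin X T \<and> x \<in> T \<and> T \<subseteq> G n"
      using opM[OF x(1)] by (intro exI conjI)
  qed
  have "\<exists>n O'. openin X O' \<and> O' \<noteq> {} \<and> O' \<subseteq> W \<and> O' \<inter> G n = {}"
  proof (rule ccontr)
    assume neg: "\<not> ?thesis"
    \<comment> \<open>Under \<open>neg\<close> each \<open>G n\<close> is dense in \<open>W\<close>.
      Adding the exterior of \<open>W\<close> makes the set dense in all of \<open>X\<close>, so
      Baire applies to \<open>X\<close> itself. A point of \<open>W\<close> in every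
      \<open>H n\<close> would lie in every \<open>G n\<close> and have infinite
      multiplicity.\<close>
    define H where "H n = G n \<union> (topspace X - X closure_of W)" for n
    have "X closure_of (\<Inter>(range H)) = topspace X"
    proof (rule Baire_category)
      show "completely_metrizable_space X \<or> locally_compact_space X \<and> regular_space X"
        using X compact_Hausdorff_imp_regular_space compact_imp_locally_compact_space by blast
      show "countable (range H)" by simp
      fix T assume "T \<in> range H"
      then obtain n where T: "T = H n" by blast
      have "openin X (H n)" unfolding H_def using opG by (intro openin_Un openin_diff) auto
      moreover have "x \<in> X closure_of (H n)" if x: "x \<in> topspace X" for x
        unfolding in_closure_of
      proof (intro conjI allI impI x)
        fix O' assume O': "x \<in> O' \<and> openin X O'"
        show "\<exists>y. y \<in> H n \<and> y \<in> O'"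
        proof (cases "O' \<inter> W = {}")
          case True
          then have "x \<notin> X closure_of W" using O' unfolding in_closure_of by blast
          then have "x \<in> H n" using x by (simp add: H_def)
          then show ?thesis using O' by blast
        next
          case False
          moreover have "openin X (O' \<inter> W)" using O' W by blast
          ultimately have "O' \<inter> W \<inter> G n \<noteq> {}" using neg by blast
          then show ?thesis unfolding H_def by blast
        qed
      qed
      ultimately show "openin X T \<and> X closure_of T = topspace X"
        using T closure_of_subset_topspace by fastforce
    qed
    moreover obtain w where w: "w \<in> W" using W by auto
    moreover have "w \<in> topspace X" using w W openin_subset by blast
    ultimately have "w \<in> X closure_of (\<Inter>(range H))" by simp
    then have "\<exists>y. y \<in> \<Inter>(range H) \<and> y \<in> W"
      unfolding in_closure_of using w W(1) by (elim conjE allE[of _ W] impE) (intro conjI)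
    then obtain y where y: "y \<in> W" "\<And>n. y \<in> H n" by blast
    have "y \<in> X closure_of W" using y(1) closure_of_subset[OF openin_subset[OF W(1)]] by blast
    then have "y \<in> G (card (M y))" using y(2)[of "card (M y)"] by (simp add: H_def)
    then show False by (simp add: G_def)
  qed
  then obtain n O' where O': "openin X O'" "O' \<noteq> {}" "O' \<subseteq> W" "O' \<inter> G n = {}" by blast
  have Osub: "O' \<subseteq> topspace X" using O'(1) openin_subset by blast
  have bd: "card (M x) < Suc n" if "x \<in> O'" for x
    using O'(4) Osub that by (force simp: G_def)
  obtain x0 where "x0 \<in> O'" using O' by blast
  then obtain x where x: "x \<in> O'" "\<And>y. y \<in> O' \<Longrightarrow> card (M y) \<le> card (M x)"
    using ex_has_greatest_nat[of "\<lambda>x. x \<in> O'" x0 "\<lambda>x. card (M x)" "Suc n"] bd less_imp_le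
    by blast
  have xt: "x \<in> topspace X" using x Osub by blast
  show ?thesis
  proof
    let ?W = "O' \<inter> (topspace X \<inter> \<Inter>(M x))"
    show "openin X ?W" using O' opM[OF xt] by blast
    show "?W \<noteq> {}" using x xt by (auto simp: M_def)
    show "?W \<subseteq> W" using O' by blast
    fix V assume V: "V \<in> \<V>"
    show "?W \<subseteq> V \<or> ?W \<inter> V = {}"
    proof (cases "x \<in> V")
      case True then show ?thesis using V by (auto simp: M_def)
    next
      case False
      have "y \<notin> V" if y: "y \<in> ?W" for y
      proof
        \<comment> \<open>Near \<open>x\<close> every set of \<open>M x\<close> persists, so a
          further set \<open>V\<close> through \<open>y\<close> would exceed the maximal
          multiplicity.\<close>
        assume "y \<in> V"
        then have "M x \<subset> M y" using mono(2)[OF xt] y V False by (auto simp: M_def)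
        then have "card (M x) < card (M y)" using fin y by (simp add: psubset_card_mono)
        then show False using x(2) y by force
      qed
      then show ?thesis by blast
    qed
  qed
qed

text \<open>A form of the Preiss--Simon theorem on Eberlein compacta.\<close>
lemma F_separated_obtains_convergent_open_sets:
  assumes X: "compact_space X" "Hausdorff_space X"
    and emb: "F_aleph0_embedded X (topspace X)"
    and p: "p \<in> topspace X" "\<not> openin X {p}"
  obtains W :: "nat \<Rightarrow> 'a set" where "\<And>n. openin X (W n)" "\<And>n. W n \<noteq> {}"
    "\<And>m n. m \<noteq> n \<Longrightarrow> W m \<inter> W n = {}"
    "\<And>x. x \<in> topspace X \<Longrightarrow> x \<noteq> p \<Longrightarrow> \<exists>T N. openin X T \<and> x \<in> T \<and> (\<forall>n\<ge>N. T \<inter> W n = {})"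
proof -
  obtain \<U> :: "nat \<Rightarrow> 'a set set" where U: "\<And>n U. U \<in> \<U> n \<Longrightarrow> openin X U"
    "\<And>n. point_finite X (\<U> n)" and sep: "F_separates X (\<Union>n. \<U> n) (topspace X)"
    using emb by (auto simp: F_aleph0_embedded_def)
  \<comment> \<open>Cumulative unions stay point-finite and increase, so a set that separates some
    pair is taken into account at all late stages.\<close>
  define \<V> where "\<V> n = (\<Union>k\<le>n. \<U> k)" for n
  have opV: "openin X V" if "V \<in> \<V> n" for V n using that U by (auto simp: \<V>_def)
  have pfV: "point_finite X (\<V> n)" for n
    unfolding \<V>_def by (rule point_finite_UN) (use U in auto)
  \<comment> \<open>\<open>W\<close> is the open set chosen at stage \<open>n\<close>, and
    \<open>N\<close> the neighbourhood of \<open>p\<close> in which everything later is chosen. The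
    last two clauses serve the two ways in which a set \<open>V\<close> can separate a point from
    \<open>p\<close>.\<close>
  define P where "P n WN \<longleftrightarrow> (case WN of (W, N) \<Rightarrow> openin X W \<and> W \<noteq> {} \<and> openin X N \<and> p \<in> N
      \<and> W \<inter> N = {} \<and> (\<forall>V\<in>\<V> n. W \<subseteq> V \<or> W \<inter> V = {}) \<and> (\<forall>V\<in>\<V> n. p \<in> V \<longrightarrow> W \<subseteq> V)
      \<and> (\<forall>V\<in>\<V> n. W \<subseteq> V \<longrightarrow> p \<notin> X closure_of V \<longrightarrow> N \<inter> V = {}))" for n :: nat and WN :: "'a set \<times> 'a set"
  have step: "\<exists>W N'. P n (W, N') \<and> W \<subseteq> N \<and> N' \<subseteq> N" if N: "openin X N" "p \<in> N" for n N
  proof -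
    define A where "A = N \<inter> (topspace X \<inter> \<Inter>{V \<in> \<V> n. p \<in> V})"
    have "finite {V \<in> \<V> n. p \<in> V}" using pfV p by (simp add: point_finite_def)
    then have opA: "openin X A"
      unfolding A_def using opV N by (intro openin_Int openin_Int_Inter) auto
    have pA: "p \<in> A" using N p by (auto simp: A_def)
    \<comment> \<open>As \<open>p\<close> is not isolated, \<open>A\<close> has another point
      \<open>y\<close>. Choosing \<open>W\<close> near \<open>y\<close>, away from \<open>B\<close>,
      leaves room for the next neighbourhood of \<open>p\<close>.\<close>
    have "A \<noteq> {p}" using opA p by blast
    then obtain y where y: "y \<in> A" "y \<noteq> p" using pA by blast
    have "y \<in> topspace X" using y by (auto simp: A_def)
    then obtain B C where BC: "openin X B" "openin X C" "p \<in> B" "y \<in> C" "disjnt B C"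
      using X(2) p y unfolding Hausdorff_space_def by metis
    have "openin X (A \<inter> C)" "A \<inter> C \<noteq> {}" using opA BC y by auto
    then obtain W where W: "openin X W" "W \<noteq> {}" "W \<subseteq> A \<inter> C"
      "\<And>V. V \<in> \<V> n \<Longrightarrow> W \<subseteq> V \<or> W \<inter> V = {}"
      using point_finite_stable_open[OF X, of "\<V> n" "A \<inter> C"] opV pfV by metis
    obtain w where w: "w \<in> W" "w \<in> topspace X" using W openin_subset by blast
    define S where "S = {V \<in> \<V> n. W \<subseteq> V \<and> p \<notin> X closure_of V}"
    have "finite {V \<in> \<V> n. w \<in> V}" using pfV w by (simp add: point_finite_def)
    \<comment> \<open>All members of \<open>S\<close> contain the point \<open>w\<close>, so
      point-finiteness applies, and removing their closures leaves an open neighbourhood of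
      \<open>p\<close>.\<close>
    then have "finite S" by (rule rev_finite_subset) (use w in \<open>auto simp: S_def\<close>)
    define N' where "N' = N \<inter> B - (\<Union>V\<in>S. X closure_of V)"
    have "openin X N'" unfolding N'_def
      using N BC \<open>finite S\<close> by (intro openin_diff openin_Int closedin_Union) auto
    moreover have "p \<in> N'" using N BC by (auto simp: N'_def S_def)
    moreover have "N' \<inter> V = {}" if "V \<in> \<V> n" "W \<subseteq> V" "p \<notin> X closure_of V" for V
      using that closure_of_subset[OF openin_subset[OF opV[OF that(1)]]] by (auto simp: N'_def S_def)
    moreover have "W \<inter> N' = {}" using W BC by (auto simp: N'_def disjnt_def)
    moreover have "W \<subseteq> V" if "V \<in> \<V> n" "p \<in> V" for V using that W by (auto simp: A_def)
    ultimately have "P n (W, N')" using W by (auto simp: P_def)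
    moreover have "W \<subseteq> N" "N' \<subseteq> N" using W by (auto simp: A_def N'_def)
    ultimately show ?thesis by blast
  qed
  have "\<exists>f. \<forall>n. P n (f n) \<and> (fst (f (Suc n)) \<subseteq> snd (f n) \<and> snd (f (Suc n)) \<subseteq> snd (f n))"
  proof (rule dependent_nat_choice)
    show "\<exists>x. P 0 x" using step[OF openin_topspace p(1)] by blast
    fix WN n assume "P n WN"
    then have "openin X (snd WN)" "p \<in> snd WN" by (auto simp: P_def)
    then show "\<exists>y. P (Suc n) y \<and> fst y \<subseteq> snd WN \<and> snd y \<subseteq> snd WN"
      using step[of "snd WN" "Suc n"] by auto
  qed
  then obtain f where f: "\<And>n. P n (f n)" "\<And>n. fst (f (Suc n)) \<subseteq> snd (f n)"
    "\<And>n. snd (f (Suc n)) \<subseteq> snd (f n)" by blast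
  define W where "W n = fst (f n)" for n
  define N where "N n = snd (f n)" for n
  have PW: "P n (W n, N n)" for n using f by (simp add: W_def N_def)
  have "antimono N" using f(3) by (simp add: decseq_Suc_iff N_def)
  have WN: "W n \<subseteq> N m" if "m < n" for m n
  proof -
    have "W n \<subseteq> N (n - 1)" using f(2)[of "n - 1"] that by (simp add: W_def N_def)
    also have "\<dots> \<subseteq> N m" using antimonoD[OF \<open>antimono N\<close>, of m "n - 1"] that by simp
    finally show ?thesis .
  qed
  have disj: "W m \<inter> W n = {}" if "m < n" for m n
    using WN[OF that] PW[of m] by (auto simp: P_def)
  show ?thesis
  proof
    show "openin X (W n)" "W n \<noteq> {}" for n using PW[of n] by (auto simp: P_def)
    show "W m \<inter> W n = {}" if "m \<noteq> n" for m n
      using disj[of m n] disj[of n m] that by (cases "m < n") auto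
    fix x assume x: "x \<in> topspace X" "x \<noteq> p"
    then obtain k V where V: "V \<in> \<U> k"
      "(x \<in> V \<and> p \<notin> X closure_of V) \<or> (p \<in> V \<and> x \<notin> X closure_of V)"
      using sep p unfolding F_separates_def by blast
    have Vn: "V \<in> \<V> n" if "n \<ge> k" for n using V that by (auto simp: \<V>_def)
    show "\<exists>T N. openin X T \<and> x \<in> T \<and> (\<forall>n\<ge>N. T \<inter> W n = {})"
      using V(2)
    proof
      \<comment> \<open>From stage \<open>k\<close> on, \<open>V\<close> swallows every
        \<open>W n\<close>, so the complement of its closure is the required neighbourhood of
        \<open>x\<close>.\<close>
      assume a: "p \<in> V \<and> x \<notin> X closure_of V"
      have "W n \<subseteq> X closure_of V" if "n \<ge> k" for n
      proof -
        have "W n \<subseteq> V" using PW[of n] Vn[OF that] a by (auto simp: P_def)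
        then show ?thesis using closure_of_subset[OF openin_subset[OF U(1)[OF V(1)]]] by blast
      qed
      then have "\<forall>n\<ge>k. (topspace X - X closure_of V) \<inter> W n = {}" by blast
      then show ?thesis using a x by (meson DiffI closedin_closure_of openin_diff openin_topspace)
    next
      \<comment> \<open>Here \<open>V\<close> itself is the neighbourhood. If it meets some
        \<open>W m\<close> with \<open>m \<ge> k\<close>, stability gives
        \<open>W m \<subseteq> V\<close>, so \<open>N m\<close> avoids \<open>V\<close>, and with it
        all later \<open>W n\<close>.\<close>
      assume a: "x \<in> V \<and> p \<notin> X closure_of V"
      have "\<exists>N. \<forall>n\<ge>N. V \<inter> W n = {}"
      proof (cases "\<exists>m\<ge>k. V \<inter> W m \<noteq> {}")
        case True
        then obtain m where m: "m \<ge> k" "V \<inter> W m \<noteq> {}" by blast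
        then have "N m \<inter> V = {}" using PW[of m] Vn[of m] a by (fastforce simp: P_def)
        then have "V \<inter> W n = {}" if "n \<ge> Suc m" for n using WN[of m n] that by auto
        then show ?thesis by blast
      qed blast
      then show ?thesis using a U(1)[OF V(1)] by blast
    qed
  qed
qed

section \<open>A bounded continuous function without extension\<close>

text \<open>Near each point the sum agrees with one finite partial sum, and these partial sums are
  pasted along the open sets where the tail vanishes. Summing over nonzero terms only keeps the
  index set finite at every point of the space.\<close>

lemma continuous_map_locally_finite_sum:
  fixes h :: "nat \<Rightarrow> 'a \<Rightarrow> real"
  assumes h: "\<And>n. continuous_map X euclideanreal (h n)"
    and lf: "\<And>x. x \<in> topspace X \<Longrightarrow> \<exists>T N. openin X T \<and> x \<in> T \<and> (\<forall>n\<ge>N. \<forall>y\<in>T. h n y = 0)"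
  shows "continuous_map X euclideanreal (\<lambda>x. \<Sum>n | h n x \<noteq> 0. h n x)"
proof -
  define \<T> where "\<T> N = {T. openin X T \<and> (\<forall>n\<ge>N. \<forall>y\<in>T. h n y = 0)}" for N
  have eq: "(\<Sum>n | h n x \<noteq> 0. h n x) = (\<Sum>n<N. h n x)" if "x \<in> \<Union>(\<T> N)" for x N
  proof (rule sum.mono_neutral_left)
    show "{n. h n x \<noteq> 0} \<subseteq> {..<N}" using that by (force simp: \<T>_def not_le[symmetric])
  qed auto
  show ?thesis
  proof (rule pasting_lemma[where I = UNIV and T = "\<lambda>N. \<Union>(\<T> N)" and f = "\<lambda>N x. \<Sum>n<N. h n x"])
    show "openin X (\<Union>(\<T> N))" for N by (rule openin_Union) (auto simp: \<T>_def)
    show "continuous_map (subtopology X (\<Union>(\<T> N))) euclideanreal (\<lambda>x. \<Sum>n<N. h n x)" for N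
      by (intro continuous_map_sum continuous_map_from_subtopology h) auto
    show "(\<Sum>n<i. h n x) = (\<Sum>n<j. h n x)" if "x \<in> topspace X \<inter> \<Union>(\<T> i) \<inter> \<Union>(\<T> j)" for i j x
      using eq[of x i] eq[of x j] that by auto
    show "\<exists>j. j \<in> UNIV \<and> x \<in> \<Union>(\<T> j) \<and> (\<Sum>n | h n x \<noteq> 0. h n x) = (\<Sum>n<j. h n x)"
      if x: "x \<in> topspace X" for x
    proof -
      obtain N where "x \<in> \<Union>(\<T> N)" using lf[OF x] by (auto simp: \<T>_def)
      then show ?thesis using eq by blast
    qed
  qed
qed

text \<open>Points \<open>y n\<close> chosen in \<open>W n\<close> converge to a point
  \<open>p\<close> outside \<open>Y\<close>, by compactness. A bounded function on \<open>Y\<close>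
  with value 1 at the even and 0 at the odd ones therefore has no continuous extension.\<close>

lemma F_aleph0_embedded_not_stone_cech:
  assumes emb: "F_aleph0_embedded X (topspace X)" and Y: "Y \<subset> topspace X"
  shows "\<not> is_stone_cech X Y"
proof
  assume sc: "is_stone_cech X Y"
  then have X: "compact_space X" "Hausdorff_space X" and dense: "X closure_of Y = topspace X"
    and ext: "\<And>f. continuous_map (subtopology X Y) euclideanreal f \<Longrightarrow> bounded (f ` Y) \<Longrightarrow>
        \<exists>g. continuous_map X euclideanreal g \<and> (\<forall>y\<in>Y. g y = f y)"
    by (auto simp: is_stone_cech_def)
  have meet: "\<exists>y. y \<in> Y \<and> y \<in> T" if "openin X T" "T \<noteq> {}" for T
    using that dense_meets_openin[OF dense that(1)] by blast
  obtain p where p: "p \<in> topspace X" "p \<notin> Y" using Y by blast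
  have "\<not> openin X {p}" using meet[of "{p}"] p by blast
  then obtain W :: "nat \<Rightarrow> 'a set" where W: "\<And>n. openin X (W n)" "\<And>n. W n \<noteq> {}"
    "\<And>m n. m \<noteq> n \<Longrightarrow> W m \<inter> W n = {}"
    and lf: "\<And>x. x \<in> topspace X \<Longrightarrow> x \<noteq> p \<Longrightarrow> \<exists>T N. openin X T \<and> x \<in> T \<and> (\<forall>n\<ge>N. T \<inter> W n = {})"
    using F_separated_obtains_convergent_open_sets[OF X emb p(1)] by metis
  have "\<forall>n. \<exists>y. y \<in> Y \<and> y \<in> W n" using meet[OF W(1,2)] by blast
  then obtain y where y: "\<And>n. y n \<in> Y" "\<And>n. y n \<in> W n" by metis
  have crs: "completely_regular_space X"
    using X by (simp add: compact_Hausdorff_or_regular_imp_normal_space normal_imp_completely_regular_space)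
  have "\<exists>h. continuous_map X euclideanreal h \<and> h (y n) = 1 \<and> (\<forall>x\<in>topspace X. 0 \<le> h x \<and> h x \<le> 1)
         \<and> (\<forall>x\<in>topspace X - W n. h x = 0)" for n
  proof -
    have "closedin X (topspace X - W n)" "y n \<in> topspace X - (topspace X - W n)"
      using W(1)[of n] y(1)[of n] y(2)[of n] Y by blast+
    \<comment> \<open>Complete regularity yields the value 0 at \<open>y n\<close> and 1 off
      \<open>W n\<close>, so the bump is \<open>1 - g\<close>.\<close>
    then obtain g where g: "continuous_map X (top_of_set {0..1}) g" "g (y n) = (0::real)"
        "g ` (topspace X - W n) \<subseteq> {1}"
      using crs unfolding completely_regular_space_def by metis
    then show ?thesis
      by (intro exI[of _ "\<lambda>x. 1 - g x"])
        (auto simp: continuous_map_in_subtopology Pi_iff image_subset_iff intro!: continuous_intros)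
  qed
  then obtain h where h: "\<And>n. continuous_map X euclideanreal (h n)" "\<And>n. h n (y n) = 1"
    "\<And>n x. x \<in> topspace X \<Longrightarrow> 0 \<le> h n x \<and> h n x \<le> 1"
    "\<And>n x. x \<in> topspace X - W n \<Longrightarrow> h n x = 0"
    by metis
  define k where "k n = (if even n then h n else (\<lambda>x. 0))" for n
  have k0: "k n x = 0" if "x \<in> topspace X - W n" for n x using h(4)[OF that] by (simp add: k_def)
  have kc: "continuous_map X euclideanreal (k n)" for n using h(1) by (simp add: k_def)
  define f where "f x = (\<Sum>n | k n x \<noteq> 0. k n x)" for x
  have fW: "f x = k n x" if x: "x \<in> W n" for n x
  proof -
    have "k m x = 0" if "m \<noteq> n" for m
      using k0[of x m] W(3)[OF that] x openin_subset[OF W(1)[of n]] by blast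
    then have "f x = (\<Sum>n\<in>{n}. k n x)"
      unfolding f_def by (intro sum.mono_neutral_left) auto
    then show ?thesis by simp
  qed
  have f01: "0 \<le> f x \<and> f x \<le> 1" if x: "x \<in> topspace X" for x
  proof (cases "\<exists>n. x \<in> W n")
    case True then show ?thesis using fW h(3)[OF x] by (auto simp: k_def)
  next
    case False
    then have "f x = 0" unfolding f_def using k0 x by (simp add: sum.neutral)
    then show ?thesis by simp
  qed
  have "continuous_map (subtopology X Y) euclideanreal f"
    unfolding f_def
  proof (rule continuous_map_locally_finite_sum)
    show "continuous_map (subtopology X Y) euclideanreal (k n)" for n
      using kc by (rule continuous_map_from_subtopology)
    \<comment> \<open>The supports accumulate only at \<open>p\<close>, which is not in
      \<open>Y\<close>; so the sum is locally finite on \<open>Y\<close>.\<close>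
    fix x assume "x \<in> topspace (subtopology X Y)"
    then have x: "x \<in> topspace X" "x \<in> Y" "x \<noteq> p" using p by auto
    then obtain T N where T: "openin X T" "x \<in> T" "\<forall>n\<ge>N. T \<inter> W n = {}" using lf[OF x(1,3)] by blast
    have "k n z = 0" if "n \<ge> N" "z \<in> T \<inter> Y" for n z
    proof (rule k0)
      show "z \<in> topspace X - W n" using that T(3) openin_subset[OF T(1)] by auto
    qed
    then show "\<exists>T N. openin (subtopology X Y) T \<and> x \<in> T \<and> (\<forall>n\<ge>N. \<forall>z\<in>T. k n z = 0)"
      using T x by (intro exI[of _ "T \<inter> Y"] exI[of _ N]) (auto simp: openin_subtopology)
  qed
  moreover have "bounded (f ` Y)"
    by (rule bounded_subset[OF bounded_closed_interval[of 0 1]]) (use f01 Y in force)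
  ultimately obtain g where g: "continuous_map X euclideanreal g" "\<And>y. y \<in> Y \<Longrightarrow> g y = f y"
    using ext by blast
  \<comment> \<open>This compact set misses \<open>p\<close>, so finitely many open sets, each
    meeting only finitely many \<open>W n\<close>, cover it. Hence it contains \<open>y n\<close>
    for only finitely many \<open>n\<close>.\<close>
  define C where "C = {x \<in> topspace X. g x \<in> {r. \<bar>r - g p\<bar> \<ge> 1/2}}"
  have "closed {r. \<bar>r - g p\<bar> \<ge> 1/2}" by (intro closed_Collect_le continuous_intros)
  then have "closedin X C"
    unfolding C_def by (intro closedin_continuous_map_preimage[OF g(1)]) auto
  then have "compactin X C" using X(1) closedin_compact_space by blast
  define \<T> where "\<T> = {T. openin X T \<and> (\<exists>N. \<forall>n\<ge>N. T \<inter> W n = {})}"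
  have "C \<subseteq> \<Union>\<T>"
  proof
    fix x assume "x \<in> C"
    then have "x \<in> topspace X" "x \<noteq> p" by (auto simp: C_def)
    from lf[OF this] obtain T N where "openin X T" "x \<in> T" "\<forall>n\<ge>N. T \<inter> W n = {}" by blast
    then show "x \<in> \<Union>\<T>" unfolding \<T>_def by blast
  qed
  then obtain \<F> where F: "finite \<F>" "\<F> \<subseteq> \<T>" "C \<subseteq> \<Union>\<F>"
    using compactinD[OF \<open>compactin X C\<close>, of \<T>] unfolding \<T>_def by blast
  have "\<forall>T\<in>\<F>. \<exists>N. \<forall>n\<ge>N. T \<inter> W n = {}" using F by (auto simp: \<T>_def)
  then obtain b where b: "\<And>T n. T \<in> \<F> \<Longrightarrow> n \<ge> b T \<Longrightarrow> T \<inter> W n = {}" by metis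
  \<comment> \<open>The sum is a convenient upper bound for the finitely many thresholds
    \<open>b T\<close>.\<close>
  define N where "N = (\<Sum>T\<in>\<F>. b T)"
  have near: "\<bar>g (y n) - g p\<bar> < 1/2" if "n \<ge> N" for n
  proof (rule ccontr)
    assume "\<not> ?thesis"
    then have "y n \<in> C" using y(1) Y by (auto simp: C_def)
    then obtain T where T: "T \<in> \<F>" "y n \<in> T" using F by blast
    have "b T \<le> N" unfolding N_def using T F by (simp add: member_le_sum)
    then show False using b[of T n] T y(2) that by auto
  qed
  have "g (y (2*N)) = 1" "g (y (2*N+1)) = 0"
    using g(2) y fW[OF y(2)] h(2) by (simp_all add: k_def)
  then show False using near[of "2*N"] near[of "2*N+1"] by simp
qed


section \<open>Point-finite families of functions from an almost subbase\<close>

text \<open>If \<open>a\<close> vanishes exactly on \<open>A\<close> and \<open>b\<close> exactly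
  off \<open>B\<close>, the quotient \<open>b / (a + b)\<close> works: a zero of \<open>a\<close>
  lies in \<open>B\<close>, so the denominator never vanishes.\<close>

lemma zero_cozero_sandwich:
  assumes A: "zero_set X A" and B: "cozero_set X B" and "A \<subseteq> B"
  shows "\<exists>g. continuous_map X euclideanreal g \<and> (\<forall>x\<in>topspace X. 0 \<le> g x \<and> g x \<le> 1)
    \<and> A = {x \<in> topspace X. g x = 1} \<and> B = {x \<in> topspace X. g x > 0}"
proof -
  obtain a where a: "continuous_map X euclideanreal a" "a ` topspace X \<subseteq> {0..1}"
    "A = {x \<in> topspace X. a x = 0}" using A by (auto simp: zero_set_def)
  obtain b where b: "continuous_map X euclideanreal b" "b ` topspace X \<subseteq> {0..1}"
    "B = topspace X - {x \<in> topspace X. b x = 0}" using B by (auto simp: cozero_set_def)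
  have nn: "0 \<le> a x" "0 \<le> b x" if "x \<in> topspace X" for x
    using a(2) b(2) that by force+
  have pos: "a x + b x > 0" if "x \<in> topspace X" for x
    using nn[OF that] that assms(3) a(3) b(3) by (cases "a x = 0") auto
  show ?thesis
  proof (intro exI[of _ "\<lambda>x. b x / (a x + b x)"] conjI ballI)
    show "continuous_map X euclideanreal (\<lambda>x. b x / (a x + b x))"
      using a b pos by (intro continuous_intros) (auto simp: less_imp_neq[symmetric])
    show "0 \<le> b x / (a x + b x)" "b x / (a x + b x) \<le> 1" if "x \<in> topspace X" for x
      using nn[OF that] pos[OF that] by (simp_all add: divide_simps)
    show "A = {x \<in> topspace X. b x / (a x + b x) = 1}"
      using a(3) pos by (force simp: field_simps)
    show "B = {x \<in> topspace X. b x / (a x + b x) > 0}"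
      using b(3) pos nn by (force simp: zero_less_divide_iff)
  qed
qed

text \<open>This carries finiteness from \<open>Y\<close> to points outside it. Were infinitely many
  \<open>P V\<close> to contain \<open>x\<close>, finitely many of them would belong to sets
  \<open>V\<close> with empty intersection; but those \<open>P V\<close> meet in a nonempty open
  set, which contains a point of \<open>Y\<close>.\<close>

lemma strongly_point_finite_finite_member:
  assumes spf: "strongly_point_finite \<A>"
    and dense: "X closure_of Y = topspace X" and op: "\<And>V. V \<in> \<A> \<Longrightarrow> openin X (P V)"
    and sub: "\<And>V. V \<in> \<A> \<Longrightarrow> P V \<inter> Y \<subseteq> V" and x: "x \<in> topspace X"
  shows "finite {V \<in> \<A>. x \<in> P V}"
proof (rule ccontr)
  assume "infinite {V \<in> \<A>. x \<in> P V}"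
  then obtain \<B> where B: "\<B> \<subseteq> {V \<in> \<A>. x \<in> P V}" "countable \<B>" "infinite \<B>"
    using infinite_countable_subset' by blast
  from B(1) have "\<B> \<subseteq> \<A>" by blast
  with B obtain \<F> where F: "\<F> \<subseteq> \<B>" "finite \<F>" "\<F> \<noteq> {}" "\<Inter>\<F> = {}"
    using spf unfolding strongly_point_finite_def by meson
  have "openin X (topspace X \<inter> \<Inter>(P ` \<F>))"
    by (rule openin_Int_Inter) (use F B op in auto)
  moreover have "x \<in> topspace X \<inter> \<Inter>(P ` \<F>)" using F B x by auto
  ultimately obtain y where "y \<in> Y" "y \<in> topspace X \<inter> \<Inter>(P ` \<F>)"
    by (rule dense_meets_openin[OF dense])
  then have "y \<in> \<Inter>\<F>" using sub F B by blast
  then show False using F by blast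
qed

text \<open>The U-representation of \<open>V\<close> gives functions on \<open>Y\<close> between its
  consecutive zero-sets and cozero-sets, and \<open>X = \<beta>Y\<close> extends them. The index
  pair records the strongly point-finite piece containing \<open>V\<close> and the level in the
  representation.\<close>

lemma E_space_point_finite_functions:
  assumes sc: "is_stone_cech X Y" and E: "E_space (subtopology X Y)"
  shows "\<exists>\<F> :: nat \<times> nat \<Rightarrow> ('a \<Rightarrow> real) set.
    (\<forall>i. \<forall>g\<in>\<F> i. continuous_map X euclideanreal g \<and> (\<forall>x\<in>topspace X. 0 \<le> g x)) \<and>
    (\<forall>i. \<forall>x\<in>topspace X. finite {g \<in> \<F> i. g x > 0}) \<and>
    (\<forall>y\<in>Y. \<forall>x\<in>topspace X. x \<noteq> y \<longrightarrow> (\<exists>i. \<exists>g\<in>\<F> i. g x \<noteq> g y))"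
proof -
  have haus: "Hausdorff_space X" and YX: "Y \<subseteq> topspace X" and dense: "X closure_of Y = topspace X"
    and ext: "\<And>f. continuous_map (subtopology X Y) euclideanreal f \<Longrightarrow> bounded (f ` Y) \<Longrightarrow>
        \<exists>g. continuous_map X euclideanreal g \<and> (\<forall>y\<in>Y. g y = f y)"
    using sc by (auto simp: is_stone_cech_def)
  have tY: "topspace (subtopology X Y) = Y" using YX by auto
  obtain \<alpha> where \<alpha>: "almost_subbase (subtopology X Y) \<alpha>" "sigma_strongly_point_finite \<alpha>"
    using E by (auto simp: E_space_def)
  obtain R where R: "\<And>V. V \<in> \<alpha> \<Longrightarrow> U_representation (subtopology X Y) V (R V)"
    and sb: "subbase (subtopology X Y) (\<alpha> \<union> {Y - R V (2*n - 1) | V n. V \<in> \<alpha> \<and> n \<ge> 1})"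
    using \<alpha>(1) unfolding almost_subbase_def tY by blast
  obtain A :: "nat \<Rightarrow> 'a set set" where A: "\<alpha> = (\<Union>k. A k)" "\<And>k. strongly_point_finite (A k)"
    using \<alpha>(2) unfolding sigma_strongly_point_finite_def by blast
  define Q where "Q V n G \<longleftrightarrow> continuous_map X euclideanreal G \<and> (\<forall>y\<in>Y. 0 \<le> G y \<and> G y \<le> 1)
      \<and> R V (2*n - 1) = {y \<in> Y. G y = 1} \<and> R V (2*n) = {y \<in> Y. G y > 0}" for V n G
  have Q: "\<exists>G. Q V n G" if V: "V \<in> \<alpha>" and n: "n \<ge> 1" for V n
  proof -
    have z: "zero_set (subtopology X Y) (R V (2*n - 1))" "cozero_set (subtopology X Y) (R V (2*n))"
      using R[OF V] n unfolding U_representation_def by blast+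
    have "R V (2*n - 1) \<subseteq> R V (Suc (2*n - 1))"
      using R[OF V] n unfolding U_representation_def by (elim conjE allE[of _ "2*n - 1"]) simp
    then have "R V (2*n - 1) \<subseteq> R V (2*n)" using n by simp
    from zero_cozero_sandwich[OF z this] obtain g where
      g: "continuous_map (subtopology X Y) euclideanreal g" "\<And>x. x \<in> Y \<Longrightarrow> 0 \<le> g x \<and> g x \<le> 1"
        "R V (2*n - 1) = {y \<in> Y. g y = 1}" "R V (2*n) = {y \<in> Y. g y > 0}"
      unfolding tY by blast
    have "bounded (g ` Y)"
      by (rule bounded_subset[OF bounded_closed_interval[of 0 1]]) (use g(2) in force)
    then obtain G where G: "continuous_map X euclideanreal G" "\<forall>y\<in>Y. G y = g y" using ext g(1) by blast
    then show ?thesis using g unfolding Q_def by (intro exI[of _ G]) auto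
  qed
  define G where "G V n = (SOME G. Q V n G)" for V n
  have QG: "Q V n (G V n)" if "V \<in> \<alpha>" "n \<ge> 1" for V n
    unfolding G_def using Q[OF that] by (rule someI_ex)
  have G: "\<And>V n. V \<in> \<alpha> \<Longrightarrow> n \<ge> 1 \<Longrightarrow> continuous_map X euclideanreal (G V n)"
    "\<And>V n y. V \<in> \<alpha> \<Longrightarrow> n \<ge> 1 \<Longrightarrow> y \<in> Y \<Longrightarrow> 0 \<le> G V n y \<and> G V n y \<le> 1"
    "\<And>V n. V \<in> \<alpha> \<Longrightarrow> n \<ge> 1 \<Longrightarrow> R V (2*n - 1) = {y \<in> Y. G V n y = 1}"
    "\<And>V n. V \<in> \<alpha> \<Longrightarrow> n \<ge> 1 \<Longrightarrow> R V (2*n) = {y \<in> Y. G V n y > 0}"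
    using QG unfolding Q_def by blast+
  have range: "0 \<le> G V n x \<and> G V n x \<le> 1" if V: "V \<in> \<alpha>" "n \<ge> 1" and x: "x \<in> topspace X" for V n x
  proof -
    \<comment> \<open>The bounds are closed conditions, so they pass from the dense set
      \<open>Y\<close> to \<open>X\<close>.\<close>
    have "closedin X {x \<in> topspace X. G V n x \<in> {0..1}}"
      by (rule closedin_continuous_map_preimage[OF G(1)[OF V]]) auto
    then have "X closure_of Y \<subseteq> {x \<in> topspace X. G V n x \<in> {0..1}}"
      using G(2)[OF V] YX by (intro closure_of_minimal) auto
    then show ?thesis using dense x by auto
  qed
  have RV: "V = (\<Union>n\<in>{1..}. R V n)" "\<And>n. n \<ge> 1 \<Longrightarrow> R V n \<subseteq> R V (Suc n)" if "V \<in> \<alpha>" for V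
    using R[OF that] unfolding U_representation_def by blast+
  have Gone: "\<exists>n\<ge>1. G V n y = 1" if V: "V \<in> \<alpha>" "y \<in> V" "y \<in> Y" for V y
  proof -
    obtain m where m: "m \<ge> 1" "y \<in> R V m" using RV(1)[OF V(1)] V(2) by auto
    have "y \<in> R V (m + i)" for i
      by (induction i) (use m RV(2)[OF V(1)] in \<open>auto simp: subset_iff\<close>)
    \<comment> \<open>Monotonicity moves from index \<open>m\<close> to the odd index
      \<open>2*m - 1\<close>, where the zero-set is the level set 1 of \<open>G V m\<close>.\<close>
    from this[of "m - 1"] have "y \<in> R V (2*m - 1)" using m by (simp add: mult_2)
    then show ?thesis using G(3)[OF V(1) m(1)] m by blast
  qed
  have Gpos: "y \<in> V" if V: "V \<in> \<alpha>" and n: "n \<ge> 1" and y: "y \<in> Y" "G V n y > 0" for V n y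
  proof -
    have "y \<in> R V (2*n)" using G(4)[OF V n] y by blast
    moreover have "2*n \<in> {1..}" using n by simp
    ultimately show ?thesis using RV(1)[OF V] by blast
  qed
  have sep: "\<exists>n V. n \<ge> 1 \<and> V \<in> \<alpha> \<and> G V n x \<noteq> G V n y"
    if y: "y \<in> Y" and x: "x \<in> topspace X" "x \<noteq> y" for x y
  proof (rule ccontr)
    assume "\<not> ?thesis"
    then have eq: "G V n x = G V n y" if "V \<in> \<alpha>" "n \<ge> 1" for V n using that by blast
    obtain O1 O2 where O: "openin X O1" "openin X O2" "y \<in> O1" "x \<in> O2" "disjnt O1 O2"
      using haus x y YX unfolding Hausdorff_space_def by (metis subsetD)
    \<comment> \<open>If no function distinguishes \<open>x\<close> from \<open>y\<close>, each
      subbasic set around \<open>y\<close> contains the trace on \<open>Y\<close> of a neighbourhood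
      of \<open>x\<close>. So points of \<open>Y\<close> near \<open>x\<close> are forced into
      \<open>O1\<close>, though \<open>O2\<close> is disjoint from it.\<close>
    have "openin (subtopology X Y) (O1 \<inter> Y)" "y \<in> O1 \<inter> Y" using O y by (auto simp: openin_subtopology)
    then obtain F where F: "finite F" "F \<subseteq> \<alpha> \<union> {Y - R V (2*n - 1) | V n. V \<in> \<alpha> \<and> n \<ge> 1}"
      "y \<in> Y \<inter> \<Inter>F" "Y \<inter> \<Inter>F \<subseteq> O1 \<inter> Y"
      using sb unfolding subbase_def tY by meson
    have "\<exists>T. openin X T \<and> x \<in> T \<and> T \<inter> Y \<subseteq> S" if S: "S \<in> F" for S
    proof -
      have yS: "y \<in> S" using F S by blast
      consider "S \<in> \<alpha>" | V n where "V \<in> \<alpha>" "n \<ge> 1" "S = Y - R V (2*n - 1)" using F S by blast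
      then show ?thesis
      proof cases
        case 1
        then obtain n where n: "n \<ge> 1" "G S n y = 1" using Gone yS y by blast
        let ?T = "{x \<in> topspace X. G S n x \<in> {0<..}}"
        have "openin X ?T" by (rule openin_continuous_map_preimage[OF G(1)[OF 1 n(1)]]) auto
        moreover have "x \<in> ?T" using x n eq[OF 1 n(1)] by simp
        moreover have "?T \<inter> Y \<subseteq> S" using Gpos[OF 1 n(1)] by auto
        ultimately show ?thesis by blast
      next
        case 2
        let ?T = "{x \<in> topspace X. G V n x \<in> {..<1}}"
        have "openin X ?T" by (rule openin_continuous_map_preimage[OF G(1)[OF 2(1,2)]]) auto
        moreover have "G V n y < 1"
          using yS 2(3) G(3)[OF 2(1,2)] G(2)[OF 2(1,2) y] y by force
        then have "x \<in> ?T" using x eq[OF 2(1,2)] by simp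
        moreover have "?T \<inter> Y \<subseteq> S" using G(3)[OF 2(1,2)] 2(3) by auto
        ultimately show ?thesis by blast
      qed
    qed
    then obtain T where T: "\<And>S. S \<in> F \<Longrightarrow> openin X (T S) \<and> x \<in> T S \<and> T S \<inter> Y \<subseteq> S" by metis
    have "openin X (O2 \<inter> \<Inter>(T ` F))" by (rule openin_Int_Inter) (use F O T in auto)
    moreover have "x \<in> O2 \<inter> \<Inter>(T ` F)" using O T by auto
    ultimately obtain z where z: "z \<in> Y" "z \<in> O2 \<inter> \<Inter>(T ` F)"
      by (rule dense_meets_openin[OF dense])
    then have "z \<in> Y \<inter> \<Inter>F" using T by blast
    then show False using F z O by (auto simp: disjnt_def)
  qed
  have fin: "finite {V \<in> A k. G V n x > 0}" if n: "n \<ge> 1" and x: "x \<in> topspace X" for k n x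
  proof -
    let ?P = "\<lambda>V. {x \<in> topspace X. G V n x \<in> {0<..}}"
    have "finite {V \<in> A k. x \<in> ?P V}"
    proof (rule strongly_point_finite_finite_member[OF A(2) dense _ _ x])
      fix V assume "V \<in> A k"
      then have V: "V \<in> \<alpha>" using A by blast
      show "openin X (?P V)" by (rule openin_continuous_map_preimage[OF G(1)[OF V n]]) auto
      show "?P V \<inter> Y \<subseteq> V" using Gpos[OF V n] by auto
    qed
    then show ?thesis using x by simp
  qed
  \<comment> \<open>The successor shifts levels to start at 1, as U-representations do.\<close>
  define \<F> where "\<F> i = (\<lambda>V. G V (Suc (snd i))) ` A (fst i)" for i
  have \<F>: "\<exists>V n. V \<in> \<alpha> \<and> n \<ge> 1 \<and> g = G V n" if "g \<in> \<F> i" for g i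
    using that A(1) unfolding \<F>_def by force
  show ?thesis
  proof (intro exI[of _ \<F>] conjI allI ballI impI)
    show "continuous_map X euclideanreal g" if "g \<in> \<F> i" for i g
      using \<F>[OF that] G(1) by blast
    show "0 \<le> g x" if "g \<in> \<F> i" "x \<in> topspace X" for i g x
      using \<F>[OF that(1)] range that(2) by blast
    show "finite {g \<in> \<F> i. g x > 0}" if x: "x \<in> topspace X" for i x
    proof -
      have "{g \<in> \<F> i. g x > 0} = (\<lambda>V. G V (Suc (snd i))) ` {V \<in> A (fst i). G V (Suc (snd i)) x > 0}"
        by (auto simp: \<F>_def)
      then show ?thesis using fin[OF _ x, of "Suc (snd i)" "fst i"] by simp
    qed
    show "\<exists>i. \<exists>g\<in>\<F> i. g x \<noteq> g y" if yx: "y \<in> Y" "x \<in> topspace X" "x \<noteq> y" for x y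
    proof -
      obtain n V k where V: "n \<ge> 1" "V \<in> A k" "G V n x \<noteq> G V n y" using sep[OF yx] A(1) by blast
      then have "G V n \<in> \<F> (k, n - 1)" by (simp add: \<F>_def)
      then show ?thesis using V by blast
    qed
  qed
qed

section \<open>Combining the families for \<open>Y\<close> and \<open>Z\<close>\<close>

lemma F_aleph0_embedded_UnionI:
  fixes \<U> :: "'i::countable \<Rightarrow> 'a set set"
  assumes "S \<subseteq> topspace X" "\<And>i U. U \<in> \<U> i \<Longrightarrow> openin X U" "\<And>i. point_finite X (\<U> i)"
    "F_separates X (\<Union>i. \<U> i) S"
  shows "F_aleph0_embedded X S"
proof -
  have "(\<Union>n. \<U> (from_nat n)) = (\<Union>i. \<U> i)" by (metis surj_from_nat image_image)
  with assms show ?thesis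
    unfolding F_aleph0_embedded_def by (intro conjI exI[of _ "\<lambda>n. \<U> (from_nat n)"]) auto
qed

theorem theorem4p5:
  fixes X :: "'a topology" and Y Z :: "'a set"
  assumes "compact_space X" and "Hausdorff_space X"
    and "Y \<subset> topspace X" and "X closure_of Y = topspace X"
    and "E_space (subtopology X Y)"
    and "Z \<subseteq> topspace X" and "F_aleph0_embedded X Z"
    and "topspace X = Y \<union> Z"
  shows "\<not> is_stone_cech X Y"
proof
  assume sc: "is_stone_cech X Y"
  obtain \<F> :: "nat \<times> nat \<Rightarrow> ('a \<Rightarrow> real) set" where
    Fs: "\<forall>i. \<forall>g\<in>\<F> i. continuous_map X euclideanreal g \<and> (\<forall>x\<in>topspace X. 0 \<le> g x)"
      "\<forall>i. \<forall>x\<in>topspace X. finite {g \<in> \<F> i. g x > 0}"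
      "\<forall>y\<in>Y. \<forall>x\<in>topspace X. x \<noteq> y \<longrightarrow> (\<exists>i. \<exists>g\<in>\<F> i. g x \<noteq> g y)"
    using E_space_point_finite_functions[OF sc assms(5)] by (elim exE conjE)
  note F = Fs(1)[rule_format, THEN conjunct1] Fs(1)[rule_format, THEN conjunct2, rule_format]
    Fs(2)[rule_format] Fs(3)[rule_format]
  obtain \<U> :: "nat \<Rightarrow> 'a set set" where U: "\<And>n U. U \<in> \<U> n \<Longrightarrow> openin X U"
    "\<And>n. point_finite X (\<U> n)" and sepZ: "F_separates X (\<Union>n. \<U> n) Z"
    using assms(7) by (auto simp: F_aleph0_embedded_def)
  define P where "P q g = {x \<in> topspace X. g x \<in> {of_rat q<..}}" for q :: rat and g :: "'a \<Rightarrow> real"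
  \<comment> \<open>Levels \<open>q \<ge> 0\<close> keep \<open>P q g\<close> inside the support of
    \<open>g\<close>, which gives point-finiteness; negative levels receive the empty
    family.\<close>
  define \<W> where "\<W> i = (case i of Inl m \<Rightarrow> \<U> m | Inr (j, q) \<Rightarrow> if q \<ge> 0 then P q ` \<F> j else {})"
    for i :: "nat + (nat \<times> nat) \<times> rat"
  have "F_aleph0_embedded X (topspace X)"
  proof (rule F_aleph0_embedded_UnionI[of _ _ \<W>])
    have opP: "openin X (P q g)" if "g \<in> \<F> j" for q g j
      unfolding P_def by (rule openin_continuous_map_preimage[OF F(1)[OF that]]) auto
    show "openin X U" if "U \<in> \<W> i" for i U
      using that U(1) opP unfolding \<W>_def by (auto split: sum.splits prod.splits if_splits)
    show "point_finite X (\<W> i)" for i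
    proof (cases "\<exists>j q. i = Inr (j, q) \<and> q \<ge> 0")
      case False
      then show ?thesis using U(2)
        by (auto simp: \<W>_def point_finite_def split: sum.splits prod.splits)
    next
      case True
      then obtain j q where i: "i = Inr (j, q)" "q \<ge> 0" by blast
      have "finite {U \<in> \<W> i. x \<in> U}" if x: "x \<in> topspace X" for x
      proof (rule finite_subset)
        have "g x > 0" if "x \<in> P q g" for g
          using that i(2) by (auto simp: P_def intro: le_less_trans[of _ "of_rat q"])
        then show "{U \<in> \<W> i. x \<in> U} \<subseteq> P q ` {g \<in> \<F> j. g x > 0}"
          using i by (auto simp: \<W>_def)
      qed (use F(3)[OF x] in auto)
      then show ?thesis by (simp add: point_finite_def)
    qed
    have lt: "\<exists>U\<in>(\<Union>i. \<W> i). x \<in> U \<and> y \<notin> X closure_of U"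
      if g: "g \<in> \<F> j" and xy: "x \<in> topspace X" "y \<in> topspace X" "g y < g x" for g j x y
    proof -
      \<comment> \<open>A rational strictly between the two values puts \<open>y\<close> outside the
        closed set where \<open>g\<close> is at least \<open>q\<close>, which contains the closure
        of \<open>P q g\<close>.\<close>
      obtain q where q: "g y < of_rat q" "of_rat q < g x" using of_rat_dense[OF xy(3)] by blast
      have "(0::real) < of_rat q" using q(1) F(2)[OF g xy(2)] by linarith
      then have "q \<ge> 0" by simp
      then have "P q g \<in> \<W> (Inr (j, q))" using g by (simp add: \<W>_def)
      moreover have "x \<in> P q g" using xy q by (simp add: P_def)
      moreover have "closedin X {x \<in> topspace X. g x \<in> {of_rat q..}}"
        by (rule closedin_continuous_map_preimage[OF F(1)[OF g]]) auto
      then have "X closure_of (P q g) \<subseteq> {x \<in> topspace X. g x \<in> {of_rat q..}}"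
        by (intro closure_of_minimal) (auto simp: P_def)
      then have "y \<notin> X closure_of (P q g)" using q by auto
      ultimately show ?thesis by blast
    qed
    have sepY: "\<exists>U\<in>(\<Union>i. \<W> i). (x \<in> U \<and> y \<notin> X closure_of U) \<or> (y \<in> U \<and> x \<notin> X closure_of U)"
      if xy: "x \<in> topspace X" "y \<in> topspace X" "x \<noteq> y" "x \<in> Y \<or> y \<in> Y" for x y
    proof -
      obtain j g where g: "g \<in> \<F> j" "g x \<noteq> g y" using F(4)[of x y] F(4)[of y x] xy by metis
      show ?thesis
      proof (cases "g y < g x")
        case True
        then show ?thesis using lt[OF g(1) xy(1,2)] by blast
      next
        case False
        then have "g x < g y" using g(2) by simp
        then show ?thesis using lt[OF g(1) xy(2,1)] by blast
      qed
    qed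
    have "\<U> n = \<W> (Inl n)" for n by (simp add: \<W>_def)
    then have UW: "(\<Union>n. \<U> n) \<subseteq> (\<Union>i. \<W> i)" by blast
    show "F_separates X (\<Union>i. \<W> i) (topspace X)"
      unfolding F_separates_def
    proof (intro ballI impI)
      fix x y assume xy: "x \<in> topspace X" "y \<in> topspace X" "x \<noteq> y"
      show "\<exists>U\<in>(\<Union>i. \<W> i). (x \<in> U \<and> y \<notin> X closure_of U) \<or> (y \<in> U \<and> x \<notin> X closure_of U)"
      proof (cases "x \<in> Y \<or> y \<in> Y")
        case True
        then show ?thesis using sepY[OF xy] by blast
      next
        case False
        \<comment> \<open>Pairs with no point in \<open>Y\<close> lie in \<open>Z\<close>, where the
          given family separates.\<close>
        then have "x \<in> Z" "y \<in> Z" using xy assms(8) by auto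
        then have "\<exists>U\<in>(\<Union>n. \<U> n). (x \<in> U \<and> y \<notin> X closure_of U) \<or> (y \<in> U \<and> x \<notin> X closure_of U)"
          using sepZ[unfolded F_separates_def, rule_format, of x y] xy(3) by blast
        then show ?thesis by (rule bexE) (rule bexI[OF _ subsetD[OF UW]])
      qed
    qed
  qed simp
  then show False using F_aleph0_embedded_not_stone_cech assms(3) sc by blast
qed

end
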